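(* Let $I$ be a normally torsion-free square-free monomial ideal in $R=K[x_1,\ldots,x_n]$ with $\mathcal{G}(I)=\{u_1,\ldots,u_m\}$. Let $S=R[x_{n+1},\ldots,x_{n+m}]$, let $f$ be a square-free monomial with $f\mid u_m$, and set $L:=(u_1,\ldots,u_{m-1})S+fx_{n+1}\cdots x_{n+m}S$. Assume $fx_{n+1}\cdots x_{n+m}\notin\mathfrak{p}^2$ for every $\mathfrak{p}\in\mathrm{Min}(L)$ and that $(u_1,\ldots,u_{m-1})S$ is normally torsion-free. Then: (i) $L$ is normally torsion-free; (ii) $L$ is nearly normally torsion-free; (iii) $L$ is normal; (iv) $L$ has the strong persistence property; (v) $L$ has the persistence property; (vi) $L$ has the symbolic strong persistence property.
   Context: $K$ is a field; $\mathcal{G}(I)$ is the minimal monomial generating set; $\mathrm{Min}(L)$ the set of minimal primes. An ideal $I$ is normally torsion-free if $\mathrm{Ass}(R/I^k)\subseteq\mathrm{Ass}(R/I)$ for all $k\ge1$. A monomial ideal $I$ is nearly normally torsion-free if there exist a positive integer $k$ and a monomial prime ideal $\mathfrak{p}$ such that $\mathrm{Ass}(R/I^t)=\mathrm{Min}(I)$ for $1\le t\le k$ and $\mathrm{Ass}(R/I^t)\subseteq\mathrm{Min}(I)\cup\{\mathfrak{p}\}$ for all $t\ge k+1$. $I$ is normal if all powers $I^k$ are integrally closed. Persistence property: $\mathrm{Ass}(R/I^k)\subseteq\mathrm{Ass}(R/I^{k+1})$ for all $k\ge1$; strong persistence property: $(I^{k+1}:I)=I^k$ for all $k\geq1$;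 symbolic strong persistence property: $(I^{(k+1)}:I^{(1)})=I^{(k)}$ for all $k\ge1$, where $I^{(k)}=\bigcap_{\mathfrak{p}\in\mathrm{Min}(I)}(I^kR_\mathfrak{p}\cap R)$. *)

theory Defs
  imports Main "HOL-Library.Poly_Mapping"
begin

section \<open>Ideal-theoretic notions relative to a subring carrier C of a commutative ring\<close>

definition ideal_in :: "'a::comm_ring_1 set \<Rightarrow> 'a set \<Rightarrow> bool" where
  "ideal_in C I \<longleftrightarrow> I \<subseteq> C \<and> 0 \<in> I \<and> (\<forall>a\<in>I. \<forall>b\<in>I. a + b \<in> I)
     \<and> (\<forall>r\<in>C. \<forall>a\<in>I. r * a \<in> I)"

definition gen :: "'a::comm_ring_1 set \<Rightarrow> 'a set \<Rightarrow> 'a set" where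
  "gen C G = \<Inter>{J. ideal_in C J \<and> G \<subseteq> J}"

definition ipow :: "'a::comm_ring_1 set \<Rightarrow> 'a set \<Rightarrow> nat \<Rightarrow> 'a set" where
  "ipow C I k = gen C {prod_list xs | xs. length xs = k \<and> set xs \<subseteq> I}"

definition colon :: "'a::comm_ring_1 set \<Rightarrow> 'a set \<Rightarrow> 'a set \<Rightarrow> 'a set" where
  "colon C I J = {r \<in> C. \<forall>a\<in>J. r * a \<in> I}"

definition prime_in :: "'a::comm_ring_1 set \<Rightarrow> 'a set \<Rightarrow> bool" where
  "prime_in C P \<longleftrightarrow> ideal_in C P \<and> P \<noteq> C \<and>
     (\<forall>a\<in>C. \<forall>b\<in>C. a * b \<in> P \<longrightarrow> a \<in> P \<or> b \<in> P)"

definition Ass :: "'a::comm_ring_1 set \<Rightarrow> 'a set \<Rightarrow> 'a set set" where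
  "Ass C I = {P. prime_in C P \<and> (\<exists>g\<in>C. P = colon C I {g})}"

definition Min_primes :: "'a::comm_ring_1 set \<Rightarrow> 'a set \<Rightarrow> 'a set set" where
  "Min_primes C I = {P. prime_in C P \<and> I \<subseteq> P \<and>
     (\<forall>Q. prime_in C Q \<and> I \<subseteq> Q \<and> Q \<subseteq> P \<longrightarrow> Q = P)}"

definition normally_torsion_free :: "'a::comm_ring_1 set \<Rightarrow> 'a set \<Rightarrow> bool" where
  "normally_torsion_free C I \<longleftrightarrow> (\<forall>k\<ge>1. Ass C (ipow C I k) \<subseteq> Ass C I)"

definition integral_over :: "'a::comm_ring_1 set \<Rightarrow> 'a set \<Rightarrow> 'a \<Rightarrow> bool" where
  "integral_over C I r \<longleftrightarrow> (\<exists>d\<ge>1. \<exists>a. (\<forall>i\<in>{1..d}. a i \<in> ipow C I i) \<and>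
      r ^ d + (\<Sum>i=1..d. a i * r ^ (d - i)) = 0)"

definition integral_closure :: "'a::comm_ring_1 set \<Rightarrow> 'a set \<Rightarrow> 'a set" where
  "integral_closure C I = {r \<in> C. integral_over C I r}"

definition normal_ideal :: "'a::comm_ring_1 set \<Rightarrow> 'a set \<Rightarrow> bool" where
  "normal_ideal C I \<longleftrightarrow> (\<forall>k\<ge>1. integral_closure C (ipow C I k) = ipow C I k)"

definition persistence :: "'a::comm_ring_1 set \<Rightarrow> 'a set \<Rightarrow> bool" where
  "persistence C I \<longleftrightarrow> (\<forall>k\<ge>1. Ass C (ipow C I k) \<subseteq> Ass C (ipow C I (k+1)))"

definition strong_persistence :: "'a::comm_ring_1 set \<Rightarrow> 'a set \<Rightarrow> bool" where
  "strong_persistence C I \<longleftrightarrow> (\<forall>k\<ge>1. colon C (ipow C I (k+1)) I = ipow C I k)"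

text \<open>symbolic power: intersection over minimal primes p of I^k R_p \<inter> R\<close>
definition symb_pow :: "'a::comm_ring_1 set \<Rightarrow> 'a set \<Rightarrow> nat \<Rightarrow> 'a set" where
  "symb_pow C I k = {r \<in> C. \<forall>P\<in>Min_primes C I. \<exists>s\<in>C - P. s * r \<in> ipow C I k}"

definition symbolic_strong_persistence :: "'a::comm_ring_1 set \<Rightarrow> 'a set \<Rightarrow> bool" where
  "symbolic_strong_persistence C I \<longleftrightarrow>
     (\<forall>k\<ge>1. colon C (symb_pow C I (k+1)) (symb_pow C I 1) = symb_pow C I k)"

type_synonym 'k mpoly = "(nat \<Rightarrow>\<^sub>0 nat) \<Rightarrow>\<^sub>0 'k"

definition polyring :: "nat set \<Rightarrow> 'k::field mpoly set" where
  "polyring V = {p :: 'k mpoly. \<forall>t\<in>Poly_Mapping.keys p. Poly_Mapping.keys t \<subseteq> V}"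

definition monom :: "(nat \<Rightarrow>\<^sub>0 nat) \<Rightarrow> 'k::field mpoly" where
  "monom t = Poly_Mapping.single t 1"

definition var :: "nat \<Rightarrow> 'k::field mpoly" where
  "var i = monom (Poly_Mapping.single i 1)"

definition is_monomial :: "'k::field mpoly \<Rightarrow> bool" where
  "is_monomial u \<longleftrightarrow> (\<exists>t. u = monom t)"

definition squarefree_monomial :: "'k::field mpoly \<Rightarrow> bool" where
  "squarefree_monomial u \<longleftrightarrow> (\<exists>t. u = monom t \<and> (\<forall>i. Poly_Mapping.lookup t i \<le> 1))"

definition monomial_ideal :: "'k::field mpoly set \<Rightarrow> 'k mpoly set \<Rightarrow> bool" where
  "monomial_ideal C I \<longleftrightarrow> ideal_in C I \<and> I = gen C {u \<in> I. is_monomial u}"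

definition mingens :: "'k::field mpoly set \<Rightarrow> 'k mpoly set" where
  "mingens I = {monom t | t. monom t \<in> I \<and>
      (\<forall>s. monom s \<in> I \<and> (\<forall>i. Poly_Mapping.lookup s i \<le> Poly_Mapping.lookup t i) \<longrightarrow> s = t)}"

definition squarefree_monomial_ideal :: "'k::field mpoly set \<Rightarrow> 'k mpoly set \<Rightarrow> bool" where
  "squarefree_monomial_ideal C I \<longleftrightarrow> monomial_ideal C I \<and> (\<forall>u\<in>mingens I. squarefree_monomial u)"

definition monomial_prime :: "'k::field mpoly set \<Rightarrow> 'k mpoly set \<Rightarrow> bool" where
  "monomial_prime C P \<longleftrightarrow> prime_in C P \<and> monomial_ideal C P"

definition nearly_normally_torsion_free :: "'k::field mpoly set \<Rightarrow> 'k mpoly set \<Rightarrow> bool" where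
  "nearly_normally_torsion_free C I \<longleftrightarrow> (\<exists>k\<ge>1. \<exists>P. monomial_prime C P \<and>
      (\<forall>t. 1 \<le> t \<and> t \<le> k \<longrightarrow> Ass C (ipow C I t) = Min_primes C I) \<and>
      (\<forall>t\<ge>k+1. Ass C (ipow C I t) \<subseteq> Min_primes C I \<union> {P}))"

end

theory Submission
  imports Defs
begin

text \<open>
  For a square-free monomial ideal with edge set \<open>E\<close>, being normally torsion-free amounts to the
  Mengerian property: a monomial lies in the \<open>k\<close>-th power as soon as its weight on every minimal
  vertex cover is at least \<open>k\<close>. Let \<open>h\<close> be the new generator and \<open>J\<close> the remaining ones, and let
  \<open>t\<close> satisfy the cover inequalities of \<open>L\<close>. If \<open>h\<close> divides \<open>t\<close>, then \<open>t/h\<close> satisfies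
  them for \<open>k - 1\<close>, because every minimal cover meets \<open>h\<close> exactly once. Otherwise some variable
  \<open>x\<close> of \<open>h\<close> does not occur in \<open>t\<close>; adding \<open>x\<close> to a cover of \<open>J\<close> gives a cover of \<open>L\<close> without
  changing the weight of \<open>t\<close>, so \<open>t\<close> already lies in the \<open>k\<close>-th power of \<open>J\<close>.
  Hence every power of \<open>L\<close> is the intersection, over the minimal covers \<open>C\<close>, of the ideals of
  polynomials of order at least \<open>k\<close> for the valuation defined by \<open>C\<close>, and all six
  assertions follow from properties of valuations.
\<close>

section \<open>Exponent vectors and polynomials\<close>

abbreviation lk :: "('a \<Rightarrow>\<^sub>0 'b::zero) \<Rightarrow> 'a \<Rightarrow> 'b" where
  "lk \<equiv> Poly_Mapping.lookup"

abbreviation supp :: "('a \<Rightarrow>\<^sub>0 'b::zero) \<Rightarrow> 'a set" where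
  "supp \<equiv> Poly_Mapping.keys"

type_synonym expo = "nat \<Rightarrow>\<^sub>0 nat"

definition exp_le :: "expo \<Rightarrow> expo \<Rightarrow> bool" where
  "exp_le s t \<longleftrightarrow> (\<forall>i. lk s i \<le> lk t i)"

lemma exp_le_diff_add: "exp_le s t \<Longrightarrow> s + (t - s) = t"
  by (rule poly_mapping_eqI) (simp add: exp_le_def lookup_add lookup_minus)

lemma supp_add_expo: "supp (s + t :: expo) = supp s \<union> supp t"
  by (auto simp: in_keys_iff lookup_add)

lemma supp_diff_expo: "supp (t - s :: expo) \<subseteq> supp t"
  by (auto simp: in_keys_iff lookup_minus)

lemma monom_mult: "monom s * monom t = (monom (s + t) :: 'k::field mpoly)"
  by (simp add: monom_def mult_single)

lemma monom_zero [simp]: "monom 0 = (1 :: 'k::field mpoly)"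
  by (simp add: monom_def)

lemma supp_monom [simp]: "supp (monom t :: 'k::field mpoly) = {t}"
  by (simp add: monom_def)

lemma monom_sum_list: "monom (sum_list es) = (prod_list (map monom es) :: 'k::field mpoly)"
  by (induction es) (simp_all add: monom_mult[symmetric])

lemma monom_sum: "finite A \<Longrightarrow> monom (sum g A) = (\<Prod>i\<in>A. monom (g i) :: 'k::field mpoly)"
  by (induction A rule: finite_induct) (simp_all add: monom_mult[symmetric])

lemma in_supp_multE:
  assumes "t \<in> supp (p * q :: 'k::field mpoly)"
  obtains a b where "a \<in> supp p" "b \<in> supp q" "t = a + b"
  using keys_mult[of p q] assms by blast

lemma sum_single_lookup: "(\<Sum>t\<in>supp p. Poly_Mapping.single t (lk p t)) = p"
proof (rule poly_mapping_eqI)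
  fix s
  have "lk (\<Sum>t\<in>supp p. Poly_Mapping.single t (lk p t)) s = (\<Sum>t\<in>supp p. if t = s then lk p t else 0)"
    by (auto simp: lookup_sum lookup_single when_def intro: sum.cong)
  also have "\<dots> = lk p s"
    by (auto simp: in_keys_iff)
  finally show "lk (\<Sum>t\<in>supp p. Poly_Mapping.single t (lk p t)) s = lk p s" .
qed

lemma lookup_mult_monom: "lk (p * monom w :: 'k::field mpoly) (t + w) = lk p t"
proof -
  have "p * monom w = (\<Sum>s\<in>supp p. Poly_Mapping.single (s + w) (lk p s))"
    by (subst sum_single_lookup[of p, symmetric])
       (simp add: sum_distrib_right monom_def mult_single del: sum_single_lookup)
  then have "lk (p * monom w) (t + w) = (\<Sum>s\<in>supp p. if s = t then lk p s else 0)"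
    by (auto simp: lookup_sum lookup_single when_def intro: sum.cong)
  also have "\<dots> = lk p t"
    by (auto simp: in_keys_iff)
  finally show ?thesis .
qed

text \<open>Translation of exponents is injective, so no terms cancel. This turns a colon by a
  monomial into a condition on shifted exponents.\<close>

lemma supp_mult_monom: "supp (p * monom w :: 'k::field mpoly) = (\<lambda>t. t + w) ` supp p"
proof
  show "supp (p * monom w) \<subseteq> (\<lambda>t. t + w) ` supp p"
    by (auto elim!: in_supp_multE)
  show "(\<lambda>t. t + w) ` supp p \<subseteq> supp (p * monom w)"
    using lookup_mult_monom[of p w] by (auto simp: in_keys_iff)
qed

section \<open>The weight of a variable set as a valuation\<close>

definition weight :: "nat set \<Rightarrow> expo \<Rightarrow> nat" where
  "weight C t = (\<Sum>i\<in>C. lk t i)"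

lemma weight_add: "weight C (s + t) = weight C s + weight C t"
  by (simp add: weight_def lookup_add sum.distrib)

lemma weight_mono_exp: "exp_le s t \<Longrightarrow> weight C s \<le> weight C t"
  by (simp add: weight_def exp_le_def sum_mono)

lemma weight_mono_set: "finite D \<Longrightarrow> C \<subseteq> D \<Longrightarrow> weight C t \<le> weight D t"
  by (simp add: weight_def sum_mono2)

lemma weight_pos_iff: "finite C \<Longrightarrow> 1 \<le> weight C t \<longleftrightarrow> C \<inter> supp t \<noteq> {}"
proof -
  assume "finite C"
  then have "weight C t = 0 \<longleftrightarrow> C \<inter> supp t = {}"
    by (auto simp: weight_def in_keys_iff)
  then show ?thesis by linarith
qed

lemma weight_single: "finite C \<Longrightarrow> weight C (Poly_Mapping.single i c) = (if i \<in> C then c else 0)"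
  by (auto simp: weight_def lookup_single when_def)

text \<open>The monomial valuation giving weight 1 to the variables in \<open>C\<close>. Phrased as
  a bound, it lets 0 have every order without an infinite value.\<close>

definition ord_ge :: "nat set \<Rightarrow> nat \<Rightarrow> 'k::field mpoly \<Rightarrow> bool" where
  "ord_ge C d p \<longleftrightarrow> (\<forall>t\<in>supp p. d \<le> weight C t)"

lemma ord_ge_0 [simp]: "ord_ge C d 0"
  by (simp add: ord_ge_def)

lemma ord_ge_trivial [simp]: "ord_ge C 0 p"
  by (simp add: ord_ge_def)

lemma ord_ge_mono: "ord_ge C d p \<Longrightarrow> e \<le> d \<Longrightarrow> ord_ge C e p"
  by (force simp: ord_ge_def)

lemma ord_ge_add: "ord_ge C d p \<Longrightarrow> ord_ge C d q \<Longrightarrow> ord_ge C d (p + q)"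
  using keys_add[of p q] by (auto simp: ord_ge_def)

lemma ord_ge_uminus: "ord_ge C d p \<Longrightarrow> ord_ge C d (- p)"
  by (auto simp: ord_ge_def in_keys_iff)

lemma ord_ge_sum: "(\<And>i. i \<in> A \<Longrightarrow> ord_ge C d (g i)) \<Longrightarrow> ord_ge C d (sum g A)"
  by (induction A rule: infinite_finite_induct) (auto intro: ord_ge_add)

lemma ord_ge_mult: "ord_ge C d p \<Longrightarrow> ord_ge C e q \<Longrightarrow> ord_ge C (d + e) (p * q)"
  unfolding ord_ge_def by (auto elim!: in_supp_multE simp: weight_add intro!: add_mono)

lemma ord_ge_power: "ord_ge C d p \<Longrightarrow> ord_ge C (d * k) (p ^ k)"
  by (induction k) (auto dest: ord_ge_mult)

text \<open>Splits off the initial form: the terms of least weight form \<open>p0\<close>, and every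
  remaining term is strictly heavier.\<close>

lemma lowest_component:
  assumes "\<not> ord_ge C (Suc d) p"
  obtains p0 p1 e where "p = p0 + p1" "p0 \<noteq> 0" "e \<le> d" "\<forall>t\<in>supp p0. weight C t = e"
    "ord_ge C (Suc e) p1"
proof -
  from assms obtain s where s: "s \<in> supp p" "weight C s \<le> d"
    by (auto simp: ord_ge_def not_less_eq_eq)
  define t where "t = arg_min_on (weight C) (supp p)"
  have t: "t \<in> supp p" "\<And>s. s \<in> supp p \<Longrightarrow> weight C t \<le> weight C s"
    using s(1) arg_min_if_finite[of "supp p" "weight C"] unfolding t_def
    by (force simp: not_less)+
  define p0 where "p0 = Poly_Mapping.mapp (\<lambda>s c. c when weight C s = weight C t) p"
  have l0: "lk p0 s = (if weight C s = weight C t then lk p s else 0)" for s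
    by (simp add: p0_def lookup_mapp when_def in_keys_iff)
  show thesis
  proof (rule that)
    show "p = p0 + (p - p0)" by simp
    show "p0 \<noteq> 0" using t(1) l0[of t] by (auto simp: in_keys_iff)
    show "weight C t \<le> d" using t(2)[OF s(1)] s(2) by simp
    show "\<forall>s\<in>supp p0. weight C s = weight C t" by (auto simp: in_keys_iff l0 split: if_splits)
    show "ord_ge C (Suc (weight C t)) (p - p0)"
      unfolding ord_ge_def
    proof
      fix s assume "s \<in> supp (p - p0)"
      then have "s \<in> supp p" "weight C s \<noteq> weight C t"
        by (auto simp: in_keys_iff lookup_minus l0 split: if_splits)
      with t(2)[of s] show "Suc (weight C t) \<le> weight C s" by simp
    qed
  qed
qed

text \<open>The product of the components of lowest weight survives because the polynomial ring is a
  domain.\<close>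

lemma not_ord_ge_mult:
  assumes "\<not> ord_ge C (Suc d) p" "\<not> ord_ge C (Suc e) q"
  shows "\<not> ord_ge C (Suc (d + e)) (p * q)"
proof -
  obtain p0 p1 d' where p: "p = p0 + p1" "p0 \<noteq> 0" "d' \<le> d" "\<forall>t\<in>supp p0. weight C t = d'"
    "ord_ge C (Suc d') p1" using lowest_component[OF assms(1)] .
  obtain q0 q1 e' where q: "q = q0 + q1" "q0 \<noteq> 0" "e' \<le> e" "\<forall>t\<in>supp q0. weight C t = e'"
    "ord_ge C (Suc e') q1" using lowest_component[OF assms(2)] .
  have p0: "ord_ge C d' p0" and q0: "ord_ge C e' q0" using p q by (auto simp: ord_ge_def)
  \<comment> \<open>Each summand of \<open>r\<close> contains a heavier part \<open>p1\<close> or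
    \<open>q1\<close>, so \<open>r\<close> has no term of weight \<open>d' + e'\<close> and cannot
    cancel a term of \<open>p0 * q0\<close>.\<close>
  define r where "r = p0 * q1 + p1 * (q0 + q1)"
  have eq: "p * q = p0 * q0 + r" by (simp add: p(1) q(1) r_def algebra_simps)
  have "ord_ge C (Suc (d' + e')) (p0 * q1)" "ord_ge C (Suc (d' + e')) (p1 * (q0 + q1))"
    using ord_ge_mult[OF p0 q(5)] ord_ge_mult[OF p(5) ord_ge_add[OF q0 ord_ge_mono[OF q(5)]]]
    by simp_all
  then have r: "ord_ge C (Suc (d' + e')) r" unfolding r_def by (rule ord_ge_add)
  have "p0 * q0 \<noteq> 0" using p(2) q(2) by simp
  then obtain t where t: "t \<in> supp (p0 * q0)" using keys_eq_empty by blast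
  then have wt: "weight C t = d' + e'" using p(4) q(4) by (auto elim!: in_supp_multE simp: weight_add)
  then have "t \<notin> supp r" using r by (auto simp: ord_ge_def)
  then have "t \<in> supp (p * q)" using t by (simp add: eq in_keys_iff lookup_add)
  then show ?thesis using wt p(3) q(3) by (auto simp: ord_ge_def intro!: bexI[of _ t])
qed

lemma not_ord_ge_power:
  assumes "\<not> ord_ge C (Suc d) p"
  shows "\<not> ord_ge C (Suc (d * k)) (p ^ k)"
proof (induction k)
  case 0
  show ?case by (simp add: ord_ge_def weight_def)
next
  case (Suc k)
  then show ?case using not_ord_ge_mult[OF assms Suc] by simp
qed

section \<open>Powers of monomial ideals\<close>

lemma polyring_add:
  fixes p q :: "'k::field mpoly"
  assumes "p \<in> polyring V" "q \<in> polyring V"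
  shows "p + q \<in> polyring V"
  using assms keys_add[of p q] unfolding polyring_def by blast

lemma polyring_mult:
  fixes p q :: "'k::field mpoly"
  assumes "p \<in> polyring V" "q \<in> polyring V"
  shows "p * q \<in> polyring V"
  unfolding polyring_def
proof (intro CollectI ballI)
  fix t assume "t \<in> supp (p * q)"
  then obtain a b where "a \<in> supp p" "b \<in> supp q" "t = a + b" by (rule in_supp_multE)
  then show "supp t \<subseteq> V" using assms by (simp add: polyring_def supp_add_expo)
qed

lemma zero_in_polyring [simp]: "(0 :: 'k::field mpoly) \<in> polyring V"
  by (simp add: polyring_def)

lemma ideal_in_polyring: "ideal_in (polyring V) (polyring V :: 'k::field mpoly set)"
  unfolding ideal_in_def using polyring_add polyring_mult zero_in_polyring by blast

lemma monom_in_polyring [simp]: "(monom t :: 'k::field mpoly) \<in> polyring V \<longleftrightarrow> supp t \<subseteq> V"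
  by (simp add: polyring_def)

lemma one_in_polyring [simp]: "(1 :: 'k::field mpoly) \<in> polyring V"
  using monom_in_polyring[of 0 V] by simp

lemma gen_superset: "G \<subseteq> gen C G"
  by (auto simp: gen_def)

lemma gen_least: "ideal_in C J \<Longrightarrow> G \<subseteq> J \<Longrightarrow> gen C G \<subseteq> J"
  by (auto simp: gen_def)

lemma ideal_in_gen: "ideal_in C C \<Longrightarrow> G \<subseteq> C \<Longrightarrow> ideal_in C (gen C G)"
proof -
  assume C: "ideal_in C C" "G \<subseteq> C"
  then have "gen C G \<subseteq> C" by (rule gen_least)
  moreover have "0 \<in> gen C G" by (simp add: gen_def ideal_in_def)
  moreover have "a + b \<in> gen C G" if "a \<in> gen C G" "b \<in> gen C G" for a b
    using that by (simp add: gen_def ideal_in_def)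
  moreover have "r * a \<in> gen C G" if "r \<in> C" "a \<in> gen C G" for r a
    using that by (simp add: gen_def ideal_in_def)
  ultimately show ?thesis by (simp add: ideal_in_def)
qed

lemma gen_of_ideal: "ideal_in C J \<Longrightarrow> gen C J = J"
  by (simp add: gen_least gen_superset subset_antisym)

lemma ideal_in_sum: "ideal_in C J \<Longrightarrow> (\<And>i. i \<in> A \<Longrightarrow> g i \<in> J) \<Longrightarrow> sum g A \<in> J"
  by (induction A rule: infinite_finite_induct) (auto simp: ideal_in_def)

text \<open>Write \<open>p\<close> as the sum of its terms; each is a multiple, inside the ring, of
  a monomial of \<open>J\<close> dividing it.\<close>

lemma ideal_in_by_terms:
  assumes J: "ideal_in (polyring V) J" and p: "p \<in> polyring V"
    and terms: "\<And>t. t \<in> supp p \<Longrightarrow> \<exists>s. exp_le s t \<and> (monom s :: 'k::field mpoly) \<in> J"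
  shows "p \<in> J"
proof -
  have "Poly_Mapping.single t (lk p t) \<in> J" if t: "t \<in> supp p" for t
  proof -
    obtain s where s: "exp_le s t" "monom s \<in> J" using terms[OF t] by blast
    have "Poly_Mapping.single (t - s) (lk p t) \<in> polyring V"
      using p t supp_diff_expo[of t s] by (auto simp: polyring_def split: if_splits)
    then have "Poly_Mapping.single (t - s) (lk p t) * monom s \<in> J"
      using J s(2) by (auto simp: ideal_in_def)
    then show ?thesis
      using exp_le_diff_add[OF s(1)] by (simp add: monom_def mult_single add.commute)
  qed
  then have "(\<Sum>t\<in>supp p. Poly_Mapping.single t (lk p t)) \<in> J"
    by (intro ideal_in_sum[OF J])
  then show ?thesis by (simp add: sum_single_lookup)
qed

text \<open>Divisibility by a product of \<open>k\<close> generators at the level of exponents. A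
  list is used because generators may repeat.\<close>

definition in_pow :: "expo set \<Rightarrow> nat \<Rightarrow> expo \<Rightarrow> bool" where
  "in_pow E k t \<longleftrightarrow> (\<exists>es. length es = k \<and> set es \<subseteq> E \<and> exp_le (sum_list es) t)"

lemma in_pow_0 [simp]: "in_pow E 0 t"
  by (simp add: in_pow_def exp_le_def)

lemma in_pow_1: "in_pow E (Suc 0) t \<longleftrightarrow> (\<exists>e\<in>E. exp_le e t)"
proof
  assume "in_pow E (Suc 0) t"
  then obtain es where es: "length es = Suc 0" "set es \<subseteq> E" "exp_le (sum_list es) t"
    unfolding in_pow_def by blast
  then obtain e where "es = [e]" by (auto simp: length_Suc_conv)
  then show "\<exists>e\<in>E. exp_le e t" using es by auto
next
  assume "\<exists>e\<in>E. exp_le e t"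
  then obtain e where "e \<in> E" "exp_le e t" by blast
  then show "in_pow E (Suc 0) t" unfolding in_pow_def by (intro exI[of _ "[e]"]) simp
qed

lemma in_pow_mono: "in_pow E k s \<Longrightarrow> exp_le s t \<Longrightarrow> in_pow E k t"
  unfolding in_pow_def exp_le_def by (metis le_trans)

lemma in_pow_subset: "in_pow E k t \<Longrightarrow> E \<subseteq> F \<Longrightarrow> in_pow F k t"
  unfolding in_pow_def by blast

lemma exp_le_add_right: "exp_le s (r + s)"
  by (simp add: exp_le_def lookup_add)

lemma in_pow_add:
  assumes "in_pow E k s" "in_pow E l t"
  shows "in_pow E (k + l) (s + t)"
proof -
  obtain es where es: "length es = k" "set es \<subseteq> E" "exp_le (sum_list es) s"
    using assms(1) by (auto simp: in_pow_def)
  obtain fs where fs: "length fs = l" "set fs \<subseteq> E" "exp_le (sum_list fs) t"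
    using assms(2) by (auto simp: in_pow_def)
  show ?thesis unfolding in_pow_def
    by (rule exI[of _ "es @ fs"]) (use es fs in \<open>auto simp: exp_le_def lookup_add intro!: add_mono\<close>)
qed

lemma in_pow_Suc:
  assumes "e \<in> E" "exp_le e t" "in_pow E k (t - e)"
  shows "in_pow E (Suc k) t"
proof -
  have "in_pow E (Suc 0) e" using assms(1) by (auto simp: in_pow_1 exp_le_def)
  from in_pow_add[OF this assms(3)] show ?thesis
    by (simp add: exp_le_diff_add[OF assms(2)])
qed

lemma ideal_in_pow:
  "ideal_in (polyring V) {p \<in> polyring V. \<forall>t\<in>supp p. in_pow E k t}" (is "ideal_in _ ?J")
proof -
  have "p + q \<in> ?J" if "p \<in> ?J" "q \<in> ?J" for p q
    using that keys_add[of p q] by (auto simp: polyring_add)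
  moreover have "r * p \<in> ?J" if "r \<in> polyring V" "p \<in> ?J" for r p
    using that in_pow_mono[OF _ exp_le_add_right] by (auto simp: polyring_mult elim!: in_supp_multE)
  moreover have "?J \<subseteq> polyring V" "0 \<in> ?J" by auto
  ultimately show ?thesis unfolding ideal_in_def by blast
qed

lemma gen_monom_eq:
  fixes V :: "nat set"
  assumes "\<forall>e\<in>E. supp e \<subseteq> V"
  shows "gen (polyring V) (monom ` E :: 'k::field mpoly set)
    = {p \<in> polyring V. \<forall>t\<in>supp p. in_pow E (Suc 0) t}" (is "?L = ?R")
proof
  show "?L \<subseteq> ?R"
    by (rule gen_least[OF ideal_in_pow]) (use assms in \<open>auto simp: in_pow_1 exp_le_def\<close>)
  have I: "ideal_in (polyring V) ?L"
    using assms by (intro ideal_in_gen ideal_in_polyring) auto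
  show "?R \<subseteq> ?L"
  proof
    fix p assume "p \<in> ?R"
    then have p: "p \<in> polyring V" "\<forall>t\<in>supp p. \<exists>e\<in>E. exp_le e t" by (simp_all add: in_pow_1)
    show "p \<in> ?L"
    proof (rule ideal_in_by_terms[OF I p(1)])
      fix t assume "t \<in> supp p"
      then show "\<exists>s. exp_le s t \<and> monom s \<in> ?L"
        using p(2) gen_superset[of "monom ` E :: 'k mpoly set" "polyring V"] by blast
    qed
  qed
qed

text \<open>The right-hand side is an ideal containing all \<open>k\<close>-fold products.
  Conversely each of its terms is divisible by a product of \<open>k\<close> generators. Questions
  about powers thereby become questions about single exponents.\<close>

lemma ipow_monom_eq:
  fixes V :: "nat set"
  assumes E: "\<forall>e\<in>E. supp e \<subseteq> V"
  shows "ipow (polyring V) (gen (polyring V) (monom ` E :: 'k::field mpoly set)) k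
    = {p \<in> polyring V. \<forall>t\<in>supp p. in_pow E k t}" (is "?L = ?R")
proof
  let ?J = "gen (polyring V) (monom ` E :: 'k mpoly set)"
  let ?G = "{prod_list xs |xs. length xs = k \<and> set xs \<subseteq> ?J}"
  have prods: "set xs \<subseteq> ?J \<Longrightarrow> prod_list xs \<in> polyring V \<and> (\<forall>t\<in>supp (prod_list xs). in_pow E (length xs) t)"
    for xs :: "'k mpoly list"
  proof (induction xs)
    case Nil
    then show ?case by simp
  next
    case (Cons x xs)
    then have "x \<in> polyring V" "\<forall>t\<in>supp x. in_pow E (Suc 0) t" by (auto simp: gen_monom_eq[OF E])
    with Cons show ?case
      using in_pow_add[of E "Suc 0" _ "length xs"]
      by (auto intro: polyring_mult elim!: in_supp_multE)
  qed
  then have G: "?G \<subseteq> ?R" by blast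
  show "?L \<subseteq> ?R" unfolding ipow_def by (rule gen_least[OF ideal_in_pow G])
  have I: "ideal_in (polyring V) ?L"
    unfolding ipow_def using G by (intro ideal_in_gen ideal_in_polyring) auto
  have monL: "monom (sum_list es) \<in> ?L" if "length es = k" "set es \<subseteq> E" for es
  proof -
    have "monom (sum_list es) \<in> ?G"
      unfolding monom_sum_list
    proof (intro CollectI exI[of _ "map monom es"] conjI refl)
      show "set (map monom es) \<subseteq> ?J"
        using that gen_superset[of "monom ` E :: 'k mpoly set" "polyring V"] by auto
    qed (use that in simp)
    then show ?thesis unfolding ipow_def by (rule subsetD[OF gen_superset])
  qed
  show "?R \<subseteq> ?L"
  proof
    fix p assume "p \<in> ?R"
    then have p: "p \<in> polyring V" "\<forall>t\<in>supp p. in_pow E k t" by simp_all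
    show "p \<in> ?L"
    proof (rule ideal_in_by_terms[OF I p(1)])
      fix t assume "t \<in> supp p"
      then show "\<exists>s. exp_le s t \<and> monom s \<in> ?L"
        using p(2) monL unfolding in_pow_def by blast
    qed
  qed
qed

section \<open>Vertex covers and monomial primes\<close>

text \<open>For finite \<open>C\<close> this is the ideal generated by the variables in
  \<open>C \<inter> V\<close>; for infinite \<open>C\<close> the weight defaults to 0 and the ideal
  is zero.\<close>

definition var_prime :: "nat set \<Rightarrow> nat set \<Rightarrow> 'k::field mpoly set" where
  "var_prime V C = {p \<in> polyring V. ord_ge C 1 p}"

lemma ideal_in_ord_ge: "ideal_in (polyring V) {p \<in> polyring V. ord_ge C d p}"
  (is "ideal_in _ ?J")
proof -
  have "r * p \<in> ?J" if "r \<in> polyring V" "p \<in> ?J" for r p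
    using that ord_ge_mult[OF ord_ge_trivial, of C d p r] by (simp add: polyring_mult)
  moreover have "p + q \<in> ?J" if "p \<in> ?J" "q \<in> ?J" for p q
    using that by (simp add: polyring_add ord_ge_add)
  moreover have "?J \<subseteq> polyring V" "0 \<in> ?J" by auto
  ultimately show ?thesis unfolding ideal_in_def by blast
qed

lemma ideal_in_var_prime: "ideal_in (polyring V) (var_prime V C :: 'k::field mpoly set)"
  unfolding var_prime_def by (rule ideal_in_ord_ge)

lemma prime_in_var_prime: "prime_in (polyring V) (var_prime V C :: 'k::field mpoly set)"
proof -
  have "(1 :: 'k mpoly) \<notin> var_prime V C"
    by (simp add: var_prime_def ord_ge_def weight_def)
  then have "(var_prime V C :: 'k mpoly set) \<noteq> polyring V"
    using one_in_polyring by blast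
  moreover have "a \<in> var_prime V C \<or> b \<in> var_prime V C"
    if "a \<in> polyring V" "b \<in> polyring V" "a * b \<in> var_prime V C" for a b :: "'k mpoly"
    using that not_ord_ge_mult[of C 0 a 0 b] by (auto simp: var_prime_def)
  ultimately show ?thesis
    by (simp add: prime_in_def ideal_in_var_prime)
qed

lemma monom_in_var_prime:
  "finite C \<Longrightarrow> (monom t :: 'k::field mpoly) \<in> var_prime V C \<longleftrightarrow> supp t \<subseteq> V \<and> C \<inter> supp t \<noteq> {}"
  using weight_pos_iff[of C t] by (simp add: var_prime_def ord_ge_def)

lemma var_in_var_prime:
  "finite C \<Longrightarrow> (var i :: 'k::field mpoly) \<in> var_prime V C \<longleftrightarrow> i \<in> V \<and> i \<in> C"
  unfolding var_def by (subst monom_in_var_prime) auto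

lemma var_prime_least:
  assumes "finite C" "ideal_in (polyring V) J" "\<And>i. i \<in> C \<Longrightarrow> (var i :: 'k::field mpoly) \<in> J"
  shows "var_prime V C \<subseteq> J"
proof
  fix p :: "'k mpoly" assume p: "p \<in> var_prime V C"
  show "p \<in> J"
  proof (rule ideal_in_by_terms[OF assms(2)])
    show "p \<in> polyring V" using p by (simp add: var_prime_def)
    fix t assume "t \<in> supp p"
    then have "1 \<le> weight C t" using p by (simp add: var_prime_def ord_ge_def)
    then obtain i where i: "i \<in> C" "i \<in> supp t" using weight_pos_iff[OF assms(1)] by blast
    then have "exp_le (Poly_Mapping.single i 1) t"
      by (auto simp: exp_le_def lookup_single when_def in_keys_iff)
    then show "\<exists>s. exp_le s t \<and> (monom s :: 'k mpoly) \<in> J"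
      using assms(3)[OF i(1)] by (auto simp: var_def)
  qed
qed

text \<open>The witness is the monomial with exponent \<open>v\<close>: its colon ideal can be
  tested term by term after shifting by \<open>v\<close>.\<close>

lemma var_prime_in_Ass:
  assumes E: "\<forall>e\<in>E. supp e \<subseteq> V" and v: "supp v \<subseteq> V"
    and eq: "\<And>t. supp t \<subseteq> V \<Longrightarrow> in_pow E k (t + v) \<longleftrightarrow> 1 \<le> weight C t"
  shows "var_prime V C \<in> Ass (polyring V) (ipow (polyring V) (gen (polyring V) (monom ` E :: 'k::field mpoly set)) k)"
proof -
  have "var_prime V C = colon (polyring V) (ipow (polyring V) (gen (polyring V) (monom ` E :: 'k mpoly set)) k) {monom v}"
  proof (rule set_eqI)
    fix p :: "'k mpoly"
    have "supp t \<subseteq> V" if "p \<in> polyring V" "t \<in> supp p" for t using that by (auto simp: polyring_def)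
    then show "p \<in> var_prime V C \<longleftrightarrow>
        p \<in> colon (polyring V) (ipow (polyring V) (gen (polyring V) (monom ` E)) k) {monom v}"
      using eq v
      by (auto simp: colon_def ipow_monom_eq[OF E] var_prime_def ord_ge_def supp_mult_monom polyring_mult)
  qed
  then show ?thesis
    using v prime_in_var_prime[of V C, where ?'k = 'k] unfolding Ass_def
    by (intro CollectI conjI bexI[of _ "monom v"]) simp_all
qed

section \<open>Minimal vertex covers and packings of edges\<close>

definition cover :: "expo set \<Rightarrow> nat set \<Rightarrow> bool" where
  "cover E C \<longleftrightarrow> (\<forall>e\<in>E. C \<inter> supp e \<noteq> {})"

definition min_cover :: "nat set \<Rightarrow> expo set \<Rightarrow> nat set \<Rightarrow> bool" where
  "min_cover V E C \<longleftrightarrow> C \<subseteq> V \<and> cover E C \<and> (\<forall>D\<subseteq>C. cover E D \<longrightarrow> D = C)"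

lemma ex_min_cover:
  assumes "finite C" "C \<subseteq> V" "cover E C"
  shows "\<exists>D\<subseteq>C. min_cover V E D"
  using assms
proof (induction C rule: finite_psubset_induct)
  case (psubset C)
  show ?case
  proof (cases "min_cover V E C")
    case False
    then obtain D where "D \<subset> C" "cover E D" using psubset.prems by (auto simp: min_cover_def)
    then show ?thesis using psubset by (meson order_trans psubset_imp_subset)
  qed blast
qed

text \<open>Removing \<open>i\<close> must leave some edge uncovered, and that edge met
  \<open>C\<close> only in \<open>i\<close>.\<close>

lemma min_cover_private_edge:
  assumes "min_cover V E C" "i \<in> C"
  shows "\<exists>e\<in>E. supp e \<inter> C = {i}"
proof -
  have "\<not> cover E (C - {i})" using assms by (auto simp: min_cover_def)
  then obtain e where "e \<in> E" "(C - {i}) \<inter> supp e = {}" by (auto simp: cover_def)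
  moreover have "C \<inter> supp e \<noteq> {}" using assms \<open>e \<in> E\<close> by (auto simp: min_cover_def cover_def)
  ultimately show ?thesis by blast
qed

text \<open>Weak duality: each of the \<open>k\<close> packed edges contributes at least 1 to the
  weight of a cover.\<close>

lemma in_pow_weight:
  assumes "finite C" "cover E C" "in_pow E k t"
  shows "k \<le> weight C t"
proof -
  obtain es where es: "length es = k" "set es \<subseteq> E" "exp_le (sum_list es) t"
    using assms by (auto simp: in_pow_def)
  have "set es \<subseteq> E \<Longrightarrow> length es \<le> weight C (sum_list es)" for es
  proof (induction es)
    case (Cons e es)
    then have "1 \<le> weight C e" using assms weight_pos_iff[of C e] by (auto simp: cover_def)
    with Cons show ?case by (simp add: weight_add)
  qed simp
  with es weight_mono_exp[OF es(3), of C] show ?thesis by fastforce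
qed

text \<open>The max-flow min-cut property of a hypergraph: \<open>t\<close> is a vector of
  capacities, and the obvious upper bound on integral edge packings coming from covers is
  attained.\<close>

definition mengerian :: "nat set \<Rightarrow> expo set \<Rightarrow> bool" where
  "mengerian V E \<longleftrightarrow> (\<forall>k t. supp t \<subseteq> V \<longrightarrow> (\<forall>C. min_cover V E C \<longrightarrow> k \<le> weight C t) \<longrightarrow> in_pow E k t)"

definition sqfree :: "expo set \<Rightarrow> bool" where
  "sqfree E \<longleftrightarrow> (\<forall>e\<in>E. \<forall>i. lk e i \<le> 1)"

text \<open>Greedy packing: pick \<open>i\<close> in \<open>P\<close> with positive capacity and
  remove its private edge. This costs one unit of the weight on \<open>P\<close> and at most one
  unit of each capacity outside \<open>P\<close>, so both bounds survive for
  \<open>k - 1\<close>.\<close>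

lemma in_pow_of_private_edges:
  assumes sq: "sqfree E" and fin: "finite P"
    and priv: "\<And>i. i \<in> P \<Longrightarrow> \<exists>e\<in>E. supp e \<subseteq> V \<and> supp e \<inter> P = {i}"
  shows "k \<le> weight P t \<Longrightarrow> (\<And>j. j \<in> V - P \<Longrightarrow> k \<le> lk t j) \<Longrightarrow> in_pow E k t"
proof (induction k arbitrary: t)
  case (Suc k)
  have "1 \<le> weight P t" using Suc.prems by simp
  then obtain i where i: "i \<in> P" "lk t i \<ge> 1"
    using weight_pos_iff[OF fin, of t] by (auto simp: in_keys_iff Suc_le_eq)
  obtain e where e: "e \<in> E" "supp e \<subseteq> V" "supp e \<inter> P = {i}" using priv[OF i(1)] by blast
  have e1: "lk e j \<le> 1" for j using sq e(1) by (auto simp: sqfree_def)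
  have le: "exp_le e t"
    unfolding exp_le_def
  proof
    fix j
    consider "j \<notin> supp e" | "j = i" | "j \<in> V - P" using e by blast
    then show "lk e j \<le> lk t j"
    proof cases
      case 1 then show ?thesis by (simp add: in_keys_iff)
    next
      case 2 then show ?thesis using e1[of j] i(2) by simp
    next
      case 3 then show ?thesis using e1[of j] Suc.prems(2)[of j] by simp
    qed
  qed
  have "lk e j = 0" if "j \<in> P - {i}" for j
  proof -
    have "j \<notin> supp e" using e(3) that by blast
    then show ?thesis by (simp add: in_keys_iff)
  qed
  then have "weight P e = lk e i"
    unfolding weight_def by (subst sum.remove[OF fin i(1)]) simp
  then have "weight P e \<le> 1" using e1[of i] by simp
  moreover have "weight P t = weight P e + weight P (t - e)"
    by (metis weight_add exp_le_diff_add[OF le])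
  ultimately have "k \<le> weight P (t - e)" using Suc.prems(1) by simp
  moreover have "k \<le> lk (t - e) j" if "j \<in> V - P" for j
    using Suc.prems(2)[OF that] e1[of j] by (simp add: lookup_minus)
  ultimately have "in_pow E k (t - e)" by (rule Suc.IH)
  then show ?case by (rule in_pow_Suc[OF e(1) le])
qed simp

section \<open>Normally torsion-free edge ideals are Mengerian\<close>

text \<open>A product of \<open>k\<close> square-free edges has all exponents at most
  \<open>k\<close>, so capacity beyond \<open>k\<close> is irrelevant.\<close>

lemma in_pow_truncate:
  assumes sq: "sqfree E" and t: "in_pow E k t" and le: "\<And>i. min k (lk t i) \<le> lk s i"
  shows "in_pow E k s"
proof -
  obtain es where es: "length es = k" "set es \<subseteq> E" "exp_le (sum_list es) t"
    using t by (auto simp: in_pow_def)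
  have len: "set es \<subseteq> E \<Longrightarrow> lk (sum_list es) i \<le> length es" for i es
  proof (induction es)
    case (Cons e es)
    then have "lk e i \<le> 1" using sq by (auto simp: sqfree_def)
    with Cons show ?case by (simp add: lookup_add)
  qed simp
  have "lk (sum_list es) i \<le> min k (lk t i)" for i
    using len[OF es(2), of i] es(1,3) by (simp add: exp_le_def)
  then have "exp_le (sum_list es) s" using le unfolding exp_le_def by (meson le_trans)
  then show ?thesis using es by (auto simp: in_pow_def)
qed

text \<open>The polynomial witness \<open>g\<close> is reduced to one exponent \<open>w\<close>: no
  monomial off \<open>P\<close> carries \<open>w\<close> into the ideal, which makes
  \<open>P\<close> a cover, while every variable of \<open>P\<close> does, which yields the private
  edges.\<close>

lemma Ass_edge_ideal_private_edges:
  fixes V :: "nat set"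
  assumes V: "\<forall>e\<in>E. supp e \<subseteq> V" and sq: "sqfree E" and fin: "finite P" and PV: "P \<subseteq> V"
    and ass: "var_prime V P \<in> Ass (polyring V) (gen (polyring V) (monom ` E :: 'k::field mpoly set))"
  shows "cover E P" and "\<And>i. i \<in> P \<Longrightarrow> \<exists>e\<in>E. supp e \<inter> P = {i}"
proof -
  obtain g :: "'k mpoly" where g: "g \<in> polyring V"
    and eq: "var_prime V P = colon (polyring V) (gen (polyring V) (monom ` E)) {g}"
    using ass by (auto simp: Ass_def)
  have mon_iff: "supp m \<inter> P \<noteq> {} \<longleftrightarrow> (\<forall>w\<in>supp g. in_pow E (Suc 0) (m + w))" if "supp m \<subseteq> V" for m
  proof -
    have "supp m \<inter> P \<noteq> {} \<longleftrightarrow> monom m * g \<in> gen (polyring V) (monom ` E)"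
      using monom_in_var_prime[OF fin, of m V, where ?'k = 'k] that eq by (auto simp: colon_def Int_commute)
    also have "\<dots> \<longleftrightarrow> (\<forall>w\<in>supp g. in_pow E (Suc 0) (m + w))"
      using that g by (auto simp: gen_monom_eq[OF V] polyring_mult mult.commute[of "monom m"]
          supp_mult_monom add.commute)
    finally show ?thesis .
  qed
  \<comment> \<open>If every term \<open>w\<close> had a multiplier \<open>m w\<close> off
    \<open>P\<close>, the product of these multipliers would carry all of \<open>g\<close> into the
    ideal, although its support misses \<open>P\<close>.\<close>
  have "\<exists>w\<in>supp g. \<forall>m. supp m \<subseteq> V - P \<longrightarrow> \<not> in_pow E (Suc 0) (m + w)"
  proof (rule ccontr)
    assume "\<not> ?thesis"
    then have "\<forall>w\<in>supp g. \<exists>m. supp m \<subseteq> V - P \<and> in_pow E (Suc 0) (m + w)" by blast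
    then obtain m where m: "\<And>w. w \<in> supp g \<Longrightarrow> supp (m w) \<subseteq> V - P \<and> in_pow E (Suc 0) (m w + w)"
      by metis
    define M where "M = sum m (supp g)"
    have supM: "supp M \<subseteq> V - P"
    proof
      fix i assume "i \<in> supp M"
      then have "(\<Sum>w\<in>supp g. lk (m w) i) \<noteq> 0" by (simp add: M_def in_keys_iff lookup_sum)
      then obtain w where "w \<in> supp g" "i \<in> supp (m w)"
        by (metis in_keys_iff sum.not_neutral_contains_not_neutral)
      then show "i \<in> V - P" using m by blast
    qed
    have "in_pow E (Suc 0) (M + w)" if "w \<in> supp g" for w
    proof -
      have "M = sum m (supp g - {w}) + m w"
        unfolding M_def by (subst sum.remove[OF finite_keys that]) (simp add: add.commute)
      then have "exp_le (m w + w) (M + w)" by (simp add: exp_le_def lookup_add)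
      then show ?thesis using m[OF that] in_pow_mono by blast
    qed
    then show False using mon_iff[of M] supM by blast
  qed
  then obtain w where w: "w \<in> supp g" "\<And>m. supp m \<subseteq> V - P \<Longrightarrow> \<not> in_pow E (Suc 0) (m + w)" by blast
  show "cover E P"
    unfolding cover_def
  proof (intro ballI notI)
    fix e assume "e \<in> E" "P \<inter> supp e = {}"
    moreover from this have "supp e \<subseteq> V - P" using V by blast
    ultimately show False using w(2)[of e] by (auto simp: in_pow_1 exp_le_def lookup_add)
  qed
  \<comment> \<open>The edge divides \<open>x_i\<close> times \<open>w\<close> but not
    \<open>w\<close> itself, so it must use \<open>x_i\<close>; square-freeness then forces
    \<open>w\<close> to vanish at \<open>i\<close>.\<close>
  have edge: "\<exists>e\<in>E. exp_le e (Poly_Mapping.single i 1 + w) \<and> lk w i = 0 \<and> lk e i = 1" if "i \<in> P" for i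
  proof -
    have "in_pow E (Suc 0) (Poly_Mapping.single i 1 + w)"
      using mon_iff[of "Poly_Mapping.single i 1"] that PV w(1) by auto
    then obtain e where e: "e \<in> E" "exp_le e (Poly_Mapping.single i 1 + w)" by (auto simp: in_pow_1)
    have "\<not> exp_le e w" using w(2)[of 0] e(1) by (auto simp: in_pow_1)
    then obtain j where j: "lk w j < lk e j" by (auto simp: exp_le_def not_le)
    moreover have "lk e j \<le> lk (Poly_Mapping.single i 1 + w) j" using e(2) by (simp add: exp_le_def)
    ultimately have "j = i" by (auto simp: lookup_add lookup_single when_def split: if_splits)
    moreover have "lk e j \<le> 1" using sq e(1) by (auto simp: sqfree_def)
    ultimately show ?thesis using e j by (intro bexI[of _ e]) auto
  qed
  fix i assume i: "i \<in> P"
  obtain e where e: "e \<in> E" "exp_le e (Poly_Mapping.single i 1 + w)" "lk e i = 1" using edge[OF i] by blast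
  \<comment> \<open>By \<open>edge\<close>, \<open>w\<close> vanishes on all of \<open>P\<close>, so
    an edge dividing \<open>x_i\<close> times \<open>w\<close> meets \<open>P\<close> only in
    \<open>i\<close>.\<close>
  have "lk e j = 0" if "j \<in> P" "j \<noteq> i" for j
    using edge[OF that(1)] e(2) that(2) by (auto simp: exp_le_def lookup_add lookup_single dest!: spec[of _ j])
  then have "supp e \<inter> P = {i}" using e(3) i by (auto simp: in_keys_iff)
  then show "\<exists>e\<in>E. supp e \<inter> P = {i}" using e(1) by blast
qed

text \<open>If \<open>t\<close> satisfies all cover inequalities but is not in the \<open>k\<close>-th power, enlarge it to an
  exponent \<open>v\<close> outside the power whose truncation at \<open>k\<close> is maximal. Since membership
  in the power only depends on the truncation, the colon ideal at \<open>v\<close> is a prime generated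
  by variables, so it is associated to the edge ideal itself; the private edges this provides then
  put \<open>v\<close> into the power.\<close>

theorem normally_torsion_free_imp_mengerian:
  fixes V :: "nat set"
  assumes finV: "finite V" and V: "\<forall>e\<in>E. supp e \<subseteq> V" and sq: "sqfree E"
    and ntf: "normally_torsion_free (polyring V) (gen (polyring V) (monom ` E :: 'k::field mpoly set))"
  shows "mengerian V E"
  unfolding mengerian_def
proof (intro allI impI, rule ccontr)
  fix k t assume t: "supp t \<subseteq> V" and cov: "\<forall>C. min_cover V E C \<longrightarrow> k \<le> weight C t"
    and nt: "\<not> in_pow E k t"
  have k: "k \<ge> 1" using nt by (cases k) auto
  define bad where "bad v \<longleftrightarrow> exp_le t v \<and> supp v \<subseteq> V \<and> \<not> in_pow E k v" for v
  \<comment> \<open>Truncation bounds \<open>\<phi>\<close> by \<open>card V * k\<close>, so a bad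
    exponent maximizing it exists even among infinitely many.\<close>
  define \<phi> where "\<phi> v = (\<Sum>i\<in>V. min k (lk v i))" for v
  have "\<phi> v \<le> card V * k" for v
    unfolding \<phi>_def using sum_bounded_above[of V "\<lambda>i. min k (lk v i)" k] by simp
  then have "\<forall>v. bad v \<longrightarrow> \<phi> v < Suc (card V * k)" by (simp add: less_Suc_eq_le)
  moreover have "bad t" using t nt by (simp add: bad_def exp_le_def)
  ultimately obtain v where v: "bad v" and max: "\<And>v'. bad v' \<Longrightarrow> \<phi> v' \<le> \<phi> v"
    using ex_has_greatest_nat[of bad t \<phi>] by blast
  \<comment> \<open>The variables carrying \<open>v\<close> into the power. Raising \<open>v\<close>
    at any other variable keeps it bad, so maximality of \<open>\<phi>\<close> forces that exponent
    to be at least \<open>k\<close> already.\<close>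
  define P where "P = {i \<in> V. in_pow E k (Poly_Mapping.single i 1 + v)}"
  have PV: "P \<subseteq> V" and finP: "finite P" using finV by (auto simp: P_def)
  have big: "k \<le> lk v i" if i: "i \<in> V - P" for i
  proof (rule ccontr)
    assume small: "\<not> k \<le> lk v i"
    let ?v' = "Poly_Mapping.single i 1 + v"
    have "bad ?v'" using i v by (auto simp: bad_def P_def exp_le_def lookup_add supp_add_expo intro: trans_le_add2)
    then have "\<phi> ?v' \<le> \<phi> v" by (rule max)
    moreover have "\<phi> v < \<phi> ?v'"
      unfolding \<phi>_def
      by (rule sum_strict_mono_ex1[OF finV]) (use i small in \<open>auto simp: lookup_add intro!: bexI[of _ i]\<close>)
    ultimately show False by simp
  qed
  have colon: "in_pow E k (s + v) \<longleftrightarrow> 1 \<le> weight P s" if s: "supp s \<subseteq> V" for s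
  proof
    assume in_s: "in_pow E k (s + v)"
    show "1 \<le> weight P s"
    proof (rule ccontr)
      assume "\<not> 1 \<le> weight P s"
      then have disj: "P \<inter> supp s = {}" using weight_pos_iff[OF finP] by blast
      have "min k (lk (s + v) i) \<le> lk v i" for i
      proof (cases "i \<in> supp s")
        case True
        then have "k \<le> lk v i" using big[of i] disj s by blast
        then show ?thesis by simp
      qed (simp add: lookup_add in_keys_iff)
      then have "in_pow E k v" by (rule in_pow_truncate[OF sq in_s])
      then show False using v by (simp add: bad_def)
    qed
  next
    assume "1 \<le> weight P s"
    then obtain i where i: "i \<in> P" "i \<in> supp s" using weight_pos_iff[OF finP] by blast
    then have "exp_le (Poly_Mapping.single i 1 + v) (s + v)"
      by (auto simp: exp_le_def lookup_add lookup_single when_def in_keys_iff)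
    then show "in_pow E k (s + v)" using i(1) in_pow_mono by (auto simp: P_def)
  qed
  have "supp v \<subseteq> V" using v by (simp add: bad_def)
  from var_prime_in_Ass[OF V this colon, where ?'k = 'k]
  have "var_prime V P \<in> Ass (polyring V) (gen (polyring V) (monom ` E :: 'k mpoly set))"
    using ntf k by (auto simp: normally_torsion_free_def)
  note ass = Ass_edge_ideal_private_edges[OF V sq finP PV this]
  \<comment> \<open>The minimal cover \<open>D\<close> inside \<open>P\<close> transfers the cover
    inequality from \<open>t\<close> to the weight of \<open>v\<close> on \<open>P\<close>, as the
    greedy packing requires.\<close>
  obtain D where D: "D \<subseteq> P" "min_cover V E D" using ex_min_cover[OF finP PV ass(1)] by blast
  have "k \<le> weight D t" using cov D by blast
  also have "\<dots> \<le> weight P t" by (rule weight_mono_set[OF finP D(1)])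
  also have "\<dots> \<le> weight P v" using v by (simp add: bad_def weight_mono_exp)
  finally have wt: "k \<le> weight P v" .
  have "\<exists>e\<in>E. supp e \<subseteq> V \<and> supp e \<inter> P = {i}" if "i \<in> P" for i
    using ass(2)[OF that] V by blast
  from in_pow_of_private_edges[OF sq finP this wt big] have "in_pow E k v" .
  then show False using v by (simp add: bad_def)
qed

section \<open>Adding an edge that meets every minimal cover once\<close>

theorem mengerian_insert:
  assumes finV: "finite V" and J: "mengerian V J" and h: "supp h \<subseteq> V" "\<forall>i. lk h i \<le> 1"
    and once: "\<And>C. min_cover V (insert h J) C \<Longrightarrow> weight C h \<le> 1"
  shows "mengerian V (insert h J)"
proof -
  have "in_pow (insert h J) k t"
    if "supp t \<subseteq> V" "\<forall>C. min_cover V (insert h J) C \<longrightarrow> k \<le> weight C t" for k t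
    using that
  proof (induction k arbitrary: t)
    case (Suc k)
    show ?case
    proof (cases "exp_le h t")
      case True
      have "k \<le> weight C (t - h)" if C: "min_cover V (insert h J) C" for C
      proof -
        have "weight C t = weight C h + weight C (t - h)"
          by (metis weight_add exp_le_diff_add[OF True])
        then show ?thesis using Suc.prems(2) C once[OF C] by fastforce
      qed
      moreover have "supp (t - h) \<subseteq> V" using supp_diff_expo Suc.prems(1) by blast
      ultimately have "in_pow (insert h J) k (t - h)" using Suc.IH by blast
      then show ?thesis by (intro in_pow_Suc[OF _ True]) simp_all
    next
      case False
      then obtain x where "\<not> lk h x \<le> lk t x" by (auto simp: exp_le_def)
      then have x: "lk t x = 0" "x \<in> supp h" using h(2)[rule_format, of x] by (auto simp: in_keys_iff)
      have "Suc k \<le> weight C t" if C: "min_cover V J C" for C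
      proof -
        have CV: "C \<subseteq> V" "finite C" using C finV finite_subset by (auto simp: min_cover_def)
        have xV: "insert x C \<subseteq> V" using x(2) h(1) CV by blast
        have "cover J C" using C by (simp add: min_cover_def)
        then have "cover (insert h J) (insert x C)" using x(2) unfolding cover_def by blast
        then obtain D where D: "D \<subseteq> insert x C" "min_cover V (insert h J) D"
          using ex_min_cover[OF _ xV] CV(2) by auto
        have "Suc k \<le> weight D t" using Suc.prems(2) D(2) by blast
        also have "\<dots> \<le> weight (insert x C) t" using D(1) CV by (intro weight_mono_set) auto
        also have "\<dots> = weight C t" using CV(2) x(1) by (cases "x \<in> C") (auto simp: weight_def insert_absorb)
        finally show ?thesis .
      qed
      then have "in_pow J (Suc k) t" using J Suc.prems(1) unfolding mengerian_def by blast
      then show ?thesis by (rule in_pow_subset) blast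
    qed
  qed simp
  then show ?thesis unfolding mengerian_def by blast
qed

section \<open>Edge ideals of Mengerian hypergraphs\<close>

lemma exact_order:
  "\<not> ord_ge C k p \<Longrightarrow> \<exists>e<k. ord_ge C e p \<and> \<not> ord_ge C (Suc e) p"
proof (induction k)
  case (Suc k)
  then show ?case by (metis less_SucI lessI)
qed simp

lemma ipow_1:
  assumes "ideal_in C J"
  shows "ipow C J 1 = J"
proof -
  have "{prod_list xs |xs. length xs = 1 \<and> set xs \<subseteq> J} = J"
  proof (intro equalityI subsetI)
    fix x assume "x \<in> {prod_list xs |xs. length xs = 1 \<and> set xs \<subseteq> J}"
    then show "x \<in> J" by (auto simp: length_Suc_conv)
  next
    fix x assume "x \<in> J"
    then show "x \<in> {prod_list xs |xs. length xs = 1 \<and> set xs \<subseteq> J}"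
      by (intro CollectI exI[of _ "[x]"]) simp
  qed
  then show ?thesis by (simp add: ipow_def gen_of_ideal[OF assms])
qed

lemma one_notin_prime: "prime_in (polyring V) P \<Longrightarrow> (1 :: 'k::field mpoly) \<notin> P"
proof
  assume P: "prime_in (polyring V) P" and "(1 :: 'k mpoly) \<in> P"
  then have "r * 1 \<in> P" if "r \<in> polyring V" for r :: "'k mpoly"
    using that unfolding prime_in_def ideal_in_def by blast
  then have "polyring V \<subseteq> P" by auto
  then show False using P by (auto simp: prime_in_def ideal_in_def)
qed

lemma prime_in_multD:
  "prime_in C P \<Longrightarrow> a \<in> C \<Longrightarrow> b \<in> C \<Longrightarrow> a * b \<in> P \<Longrightarrow> a \<in> P \<or> b \<in> P"
  by (simp add: prime_in_def)

text \<open>Peel off one variable at a time; the total degree on \<open>V\<close> drops, and the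
  exponent never reaches 0 because 1 is not in \<open>P\<close>.\<close>

lemma monom_in_prime:
  assumes finV: "finite V" and P: "prime_in (polyring V) P"
  shows "(monom t :: 'k::field mpoly) \<in> P \<Longrightarrow> supp t \<subseteq> V \<Longrightarrow> \<exists>i\<in>supp t. (var i :: 'k mpoly) \<in> P"
proof (induction "weight V t" arbitrary: t rule: less_induct)
  case less
  have "t \<noteq> 0" using less.prems(1) one_notin_prime[OF P] by auto
  then obtain i where i: "i \<in> supp t" using keys_eq_empty by blast
  let ?i = "Poly_Mapping.single i 1 :: expo"
  have "exp_le ?i t"
    using i by (auto simp: exp_le_def lookup_single when_def in_keys_iff)
  then have t: "?i + (t - ?i) = t" by (rule exp_le_diff_add)
  have sub: "supp (t - ?i) \<subseteq> supp t" by (rule supp_diff_expo)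
  have "monom t = (var i :: 'k mpoly) * monom (t - ?i)"
    unfolding var_def monom_mult t ..
  then have "(var i :: 'k mpoly) \<in> P \<or> (monom (t - ?i) :: 'k mpoly) \<in> P"
    using prime_in_multD[OF P, of "var i" "monom (t - ?i)"] less.prems i sub
    by (auto simp: var_def)
  then show ?case
  proof
    assume m: "(monom (t - ?i) :: 'k mpoly) \<in> P"
    have "weight V t = weight V ?i + weight V (t - ?i)" by (metis weight_add t)
    then have "weight V (t - ?i) < weight V t"
      using i less.prems(2) finV by (auto simp: weight_single)
    from less.hyps[OF this m] sub less.prems(2) show ?thesis by blast
  qed (use i in blast)
qed

text \<open>Splitting off one variable of \<open>C\<close> leaves weight at least 1, so both factors
  lie in the prime. This translates the hypothesis on squares of minimal primes into a bound on
  weights.\<close>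

lemma monom_in_ipow2:
  assumes "finite C" "C \<subseteq> V" "supp h \<subseteq> V" "2 \<le> weight C h"
  shows "(monom h :: 'k::field mpoly) \<in> ipow (polyring V) (var_prime V C) 2"
proof -
  obtain i where i: "i \<in> C" "i \<in> supp h" using weight_pos_iff[OF assms(1), of h] assms(4) by auto
  let ?i = "Poly_Mapping.single i 1 :: expo"
  have "exp_le ?i h" using i by (auto simp: exp_le_def lookup_single when_def in_keys_iff)
  then have t: "?i + (h - ?i) = h" by (rule exp_le_diff_add)
  have "weight C h = weight C ?i + weight C (h - ?i)" by (metis weight_add t)
  then have "1 \<le> weight C (h - ?i)" using assms(1,4) i by (simp add: weight_single)
  then have "(monom (h - ?i) :: 'k mpoly) \<in> var_prime V C"
    using supp_diff_expo[of h ?i] assms(3) by (auto simp: var_prime_def ord_ge_def)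
  moreover have "(var i :: 'k mpoly) \<in> var_prime V C" using i assms by (auto simp: var_in_var_prime)
  moreover have "monom h = prod_list [var i :: 'k mpoly, monom (h - ?i)]"
    using t by (simp add: var_def monom_mult)
  ultimately have "(monom h :: 'k mpoly) \<in> {prod_list xs |xs. length xs = 2 \<and> set xs \<subseteq> var_prime V C}"
    by (intro CollectI exI[of _ "[var i :: 'k mpoly, monom (h - ?i)]"]) simp
  then show ?thesis unfolding ipow_def by (rule subsetD[OF gen_superset])
qed

section \<open>Minimal primes of a square-free edge ideal\<close>

locale edge_ideal =
  fixes V :: "nat set" and E :: "expo set" and S L :: "'k::field mpoly set"
  assumes finV: "finite V" and EV: "\<forall>e\<in>E. supp e \<subseteq> V" and sq: "sqfree E" and ne: "E \<noteq> {}"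
    and S_def: "S = polyring V" and L_def: "L = gen S (monom ` E)"
begin

abbreviation mc :: "nat set \<Rightarrow> bool" where "mc \<equiv> min_cover V E"

lemma mc_finite: "mc C \<Longrightarrow> finite C"
  using finV finite_subset by (auto simp: min_cover_def)

lemma mc_nonempty: "mc C \<Longrightarrow> C \<noteq> {}"
  using ne unfolding min_cover_def cover_def by blast

lemma finite_mc: "finite {C. mc C}"
  by (rule finite_subset[of _ "Pow V"]) (auto simp: min_cover_def finV)

lemma S_mult: "p \<in> S \<Longrightarrow> q \<in> S \<Longrightarrow> p * q \<in> S"
  by (simp add: S_def polyring_mult)

lemma ideal_in_L: "ideal_in S L"
  unfolding L_def S_def using EV by (intro ideal_in_gen ideal_in_polyring) auto

lemma edge_in_L: "e \<in> E \<Longrightarrow> monom e \<in> L"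
  unfolding L_def by (rule subsetD[OF gen_superset]) blast

lemma L_subset_var_prime:
  assumes "mc C"
  shows "L \<subseteq> var_prime V C"
  unfolding L_def S_def
proof (rule gen_least[OF ideal_in_var_prime])
  show "monom ` E \<subseteq> (var_prime V C :: 'k mpoly set)"
    using assms EV mc_finite[OF assms] by (auto simp: monom_in_var_prime min_cover_def cover_def)
qed

text \<open>Primality puts a variable of each edge into \<open>P\<close>; these variables form a
  cover, which is then shrunk to a minimal one.\<close>

lemma prime_contains_var_prime:
  assumes P: "prime_in S P" and LP: "L \<subseteq> P"
  shows "\<exists>C. mc C \<and> (\<forall>i\<in>C. var i \<in> P) \<and> var_prime V C \<subseteq> P"
proof -
  define C0 where "C0 = {i \<in> V. (var i :: 'k mpoly) \<in> P}"
  have "cover E C0"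
    unfolding cover_def
  proof
    fix e assume e: "e \<in> E"
    then have "monom e \<in> P" using edge_in_L LP by blast
    then obtain i where "i \<in> supp e" "(var i :: 'k mpoly) \<in> P"
      using monom_in_prime[OF finV P[unfolded S_def], of e] EV e by blast
    then show "C0 \<inter> supp e \<noteq> {}" using EV e by (auto simp: C0_def)
  qed
  moreover have C0V: "C0 \<subseteq> V" by (auto simp: C0_def)
  ultimately obtain C where C: "C \<subseteq> C0" "mc C"
    using ex_min_cover[of C0 V E] finite_subset[OF _ finV] by blast
  then have vars: "\<forall>i\<in>C. (var i :: 'k mpoly) \<in> P" by (auto simp: C0_def)
  moreover have "ideal_in (polyring V) P" using P by (simp add: prime_in_def S_def)
  then have "var_prime V C \<subseteq> P" using vars by (intro var_prime_least[OF mc_finite[OF C(2)]]) auto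
  ultimately show ?thesis using C(2) by blast
qed

text \<open>Every prime over \<open>L\<close> lies above the variable prime of a minimal cover, and
  inclusions among variable primes reflect inclusions among covers.\<close>

lemma Min_primes_L: "Min_primes S L = var_prime V ` {C. mc C}"
proof (intro equalityI subsetI)
  fix P assume "P \<in> Min_primes S L"
  then have P: "prime_in S P" "L \<subseteq> P" and min: "\<And>Q. prime_in S Q \<Longrightarrow> L \<subseteq> Q \<Longrightarrow> Q \<subseteq> P \<Longrightarrow> Q = P"
    by (auto simp: Min_primes_def)
  obtain C where C: "mc C" "var_prime V C \<subseteq> P" using prime_contains_var_prime[OF P] by blast
  have "var_prime V C = P"
    by (rule min) (use C L_subset_var_prime prime_in_var_prime S_def in auto)
  then show "P \<in> var_prime V ` {C. mc C}" using C(1) by blast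
next
  fix P :: "'k mpoly set" assume "P \<in> var_prime V ` {C. mc C}"
  then obtain C where C: "mc C" "P = var_prime V C" by blast
  have "Q = P" if Q: "prime_in S Q" "L \<subseteq> Q" "Q \<subseteq> P" for Q
  proof -
    obtain D where D: "mc D" "\<forall>i\<in>D. var i \<in> Q" "var_prime V D \<subseteq> Q"
      using prime_contains_var_prime[OF Q(1,2)] by blast
    then have "\<forall>i\<in>D. (var i :: 'k mpoly) \<in> var_prime V C" using Q(3) C(2) by blast
    then have "D \<subseteq> C" using var_in_var_prime[OF mc_finite[OF C(1)]] by blast
    then have "D = C" using C(1) D(1) by (simp add: min_cover_def)
    then show ?thesis using D(3) C(2) Q(3) by blast
  qed
  then show "P \<in> Min_primes S L"
    using C L_subset_var_prime prime_in_var_prime[of V C] by (auto simp: Min_primes_def S_def)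
qed

end

section \<open>Powers and associated primes in the Mengerian case\<close>

locale mengerian_ideal = edge_ideal V E S L
  for V :: "nat set" and E :: "expo set" and S L :: "'k::field mpoly set" +
  assumes meng: "mengerian V E"
begin

text \<open>Weak duality gives one inclusion and \<open>meng\<close> the other.\<close>

lemma ipow_L: "ipow S L k = {p \<in> S. \<forall>C. mc C \<longrightarrow> ord_ge C k p}"
proof -
  have "in_pow E k t \<longleftrightarrow> (\<forall>C. mc C \<longrightarrow> k \<le> weight C t)" if "supp t \<subseteq> V" for t
  proof
    assume "in_pow E k t"
    then show "\<forall>C. mc C \<longrightarrow> k \<le> weight C t"
      using in_pow_weight mc_finite by (auto simp: min_cover_def)
  qed (use meng that in \<open>auto simp: mengerian_def\<close>)
  then show ?thesis
    unfolding L_def S_def ipow_monom_eq[OF EV] by (auto simp: ord_ge_def polyring_def)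
qed

lemma var_prime_in_Ass_ipow:
  assumes C: "mc C" and k: "k \<ge> 1"
  shows "var_prime V C \<in> Ass S (ipow S L k)"
proof -
  have finC: "finite C" by (rule mc_finite[OF C])
  obtain i where i: "i \<in> C" using mc_nonempty[OF C] by blast
  \<comment> \<open>Weight \<open>k - 1\<close> on \<open>C\<close>, one short of the power, and
    exponent \<open>k\<close> off \<open>C\<close>: any variable of \<open>C\<close> supplies the
    missing unit, and private edges then give the packing.\<close>
  define v where "v = (\<Sum>j\<in>V - C. Poly_Mapping.single j k) + Poly_Mapping.single i (k - 1)"
  have lv: "lk v j = (if j \<in> V - C then k else 0) + (if j = i then k - 1 else 0)" for j
    using finV by (auto simp: v_def lookup_add lookup_sum lookup_single when_def)
  have "supp v \<subseteq> V" using i C by (auto simp: in_keys_iff lv min_cover_def split: if_splits)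
  moreover have "in_pow E k (t + v) \<longleftrightarrow> 1 \<le> weight C t" if "supp t \<subseteq> V" for t
  proof -
    have "weight C v = (\<Sum>j\<in>C. if j = i then k - 1 else 0)"
      unfolding weight_def by (intro sum.cong) (auto simp: lv)
    then have wv: "weight C v = k - 1" using i finC by simp
    show ?thesis
    proof
      assume "in_pow E k (t + v)"
      then have "k \<le> weight C (t + v)" using C by (intro in_pow_weight[OF finC]) (auto simp: min_cover_def)
      then show "1 \<le> weight C t" using wv k by (simp add: weight_add)
    next
      assume "1 \<le> weight C t"
      then have "k \<le> weight C (t + v)" using wv k by (simp add: weight_add)
      moreover have "k \<le> lk (t + v) j" if "j \<in> V - C" for j using that by (simp add: lookup_add lv)
      moreover have "\<exists>e\<in>E. supp e \<subseteq> V \<and> supp e \<inter> C = {j}" if "j \<in> C" for j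
        using min_cover_private_edge[OF C that] EV by blast
      ultimately show "in_pow E k (t + v)" by (intro in_pow_of_private_edges[OF sq finC, of V])
    qed
  qed
  ultimately show ?thesis
    unfolding S_def L_def by (rule var_prime_in_Ass[OF EV])
qed

text \<open>\<open>P\<close> is a finite intersection, over the minimal covers, of the ideals of all
  \<open>a\<close> for which \<open>a * g\<close> has order at least \<open>k\<close>. A prime equal
  to such an intersection contains one of its members, and the cover of that member determines
  \<open>P\<close>.\<close>

lemma Ass_ipow_subset:
  assumes k: "k \<ge> 1" and P: "P \<in> Ass S (ipow S L k)"
  shows "\<exists>C. mc C \<and> P = var_prime V C"
proof -
  obtain g where g: "g \<in> S" and Pg: "P = colon S (ipow S L k) {g}" and prime: "prime_in S P"
    using P by (auto simp: Ass_def)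
  have inP: "a \<in> P \<longleftrightarrow> a \<in> S \<and> (\<forall>C. mc C \<longrightarrow> ord_ge C k (a * g))" for a
  proof -
    have "a * g \<in> S" if "a \<in> S" using that g by (rule S_mult)
    then show ?thesis by (auto simp: Pg colon_def ipow_L)
  qed
  have idealP: "ideal_in S P" using prime by (simp add: prime_in_def)
  have "\<exists>C. mc C \<and> \<not> ord_ge C k g \<and> (\<forall>a\<in>S. ord_ge C k (a * g) \<longrightarrow> a \<in> P)"
  proof (rule ccontr)
    assume "\<not> ?thesis"
    then have "\<forall>C. mc C \<longrightarrow> ord_ge C k g \<or> (\<exists>a. a \<in> S \<and> a \<notin> P \<and> ord_ge C k (a * g))" by blast
    moreover have "1 \<in> S" "1 \<notin> P" using one_notin_prime[OF prime[unfolded S_def]] by (auto simp: S_def)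
    \<comment> \<open>A cover on which \<open>g\<close> already has order \<open>k\<close> takes the
      multiplier 1. The product of all multipliers then avoids \<open>P\<close> yet carries
      \<open>g\<close> into the power.\<close>
    ultimately have "\<forall>C. \<exists>a. mc C \<longrightarrow> a \<in> S \<and> a \<notin> P \<and> ord_ge C k (a * g)" by (metis mult_1)
    then obtain a where a: "\<And>C. mc C \<Longrightarrow> a C \<in> S \<and> a C \<notin> P \<and> ord_ge C k (a C * g)" by metis
    have prod_notin: "prod a B \<in> S \<and> prod a B \<notin> P" if "B \<subseteq> {C. mc C}" for B
      using finite_subset[OF that finite_mc] that
    proof (induction B rule: finite_induct)
      case empty
      then show ?case using \<open>1 \<in> S\<close> \<open>1 \<notin> P\<close> by simp
    next
      case (insert C B)
      then have "a C \<in> S" "a C \<notin> P" "prod a B \<in> S" "prod a B \<notin> P" using a by auto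
      then show ?case
        using insert.hyps prime_in_multD[OF prime] by (auto simp: S_mult)
    qed
    let ?A = "prod a {C. mc C}"
    have "ord_ge C k (?A * g)" if C: "mc C" for C
    proof -
      have "?A = prod a ({C. mc C} - {C}) * a C"
        using C by (subst prod.remove[OF finite_mc, of C]) (auto simp: mult.commute)
      then have "?A * g = prod a ({C. mc C} - {C}) * (a C * g)" by (simp only: mult.assoc)
      moreover have "ord_ge C (0 + k) (prod a ({C. mc C} - {C}) * (a C * g))"
        using a[OF C] by (intro ord_ge_mult) auto
      ultimately show ?thesis by (simp only: add_0)
    qed
    then show False using inP[of ?A] prod_notin[of "{C. mc C}"] by blast
  qed
  then obtain C where C: "mc C" "\<not> ord_ge C k g" "\<And>a. a \<in> S \<Longrightarrow> ord_ge C k (a * g) \<Longrightarrow> a \<in> P" by blast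
  have finC: "finite C" by (rule mc_finite[OF C(1)])
  have "P \<subseteq> var_prime V C"
  proof
    fix a assume a: "a \<in> P"
    have "ord_ge C 1 a"
    proof (rule ccontr)
      assume "\<not> ord_ge C 1 a"
      then have "\<not> ord_ge C (Suc (0 + (k - 1))) (a * g)"
        by (intro not_ord_ge_mult) (use C(2) k in auto)
      then show False using inP a C(1) k by auto
    qed
    then show "a \<in> var_prime V C" using a inP by (simp add: var_prime_def S_def)
  qed
  moreover have "var_prime V C \<subseteq> P"
  proof (rule var_prime_least[OF finC idealP[unfolded S_def]])
    fix i assume i: "i \<in> C"
    then have iV: "i \<in> V" using C(1) by (auto simp: min_cover_def)
    \<comment> \<open>The \<open>k\<close>-th power of \<open>x_i\<close> has order \<open>k\<close>
      by itself, so it lies in \<open>P\<close>, and primality yields \<open>x_i\<close>.\<close>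
    let ?t = "Poly_Mapping.single i k :: expo"
    have "ord_ge C k (monom ?t :: 'k mpoly)" using i finC by (simp add: ord_ge_def weight_single)
    then have "ord_ge C k (monom ?t * g)" using ord_ge_mult[OF _ ord_ge_trivial, of C k "monom ?t" g] by simp
    moreover have tV: "supp ?t \<subseteq> V" using iV by auto
    ultimately have "monom ?t \<in> P" by (intro C(3)) (auto simp: S_def)
    then have "\<exists>j\<in>supp ?t. (var j :: 'k mpoly) \<in> P"
      by (rule monom_in_prime[OF finV prime[unfolded S_def] _ tV])
    then show "(var i :: 'k mpoly) \<in> P" by (auto split: if_splits)
  qed
  ultimately show ?thesis using C(1) by blast
qed

lemma Ass_ipow: "k \<ge> 1 \<Longrightarrow> Ass S (ipow S L k) = Min_primes S L"
  unfolding Min_primes_L using Ass_ipow_subset var_prime_in_Ass_ipow by auto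

lemma Ass_L: "Ass S L = Min_primes S L"
  using Ass_ipow[of 1] ipow_1[OF ideal_in_L] by simp

section \<open>The six properties read off from the valuations\<close>

lemma ntf_L: "normally_torsion_free S L"
  by (simp add: normally_torsion_free_def Ass_ipow Ass_L)

lemma persistence_L: "persistence S L"
  by (simp add: persistence_def Ass_ipow)

text \<open>Supplies the witness for the extra prime in
  \<open>nearly_normally_torsion_free\<close>.\<close>

lemma monomial_prime_zero: "monomial_prime S {0}"
proof -
  have z: "ideal_in S {0}" by (simp add: ideal_in_def S_def)
  have "1 \<in> S" by (simp add: S_def)
  then have "{0} \<noteq> S" by force
  then have "prime_in S {0}" using z by (simp add: prime_in_def)
  moreover have "\<not> is_monomial (0 :: 'k mpoly)"
    unfolding is_monomial_def by (metis insert_not_empty keys_zero supp_monom)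
  then have "{u \<in> {0}. is_monomial u} = ({} :: 'k mpoly set)" by blast
  moreover have "gen S {} = ({0} :: 'k mpoly set)"
    using gen_least[OF z, of "{}"] by (auto simp: gen_def ideal_in_def)
  ultimately show ?thesis using z unfolding monomial_prime_def monomial_ideal_def by presburger
qed

lemma nearly_ntf_L: "nearly_normally_torsion_free S L"
  unfolding nearly_normally_torsion_free_def
  using monomial_prime_zero by (intro exI[of _ 1] conjI exI[of _ "{0}"]) (auto simp: Ass_ipow)

text \<open>A private edge of \<open>C\<close> has weight at most 1, so if \<open>r\<close> had
  order below \<open>k\<close>, its product with that edge would have order below
  \<open>k + 1\<close>.\<close>

lemma strong_persistence_L: "strong_persistence S L"
  unfolding strong_persistence_def
proof (intro allI impI equalityI subsetI)
  fix k r assume "r \<in> colon S (ipow S L (k + 1)) L"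
  then have r: "r \<in> S" "\<And>a. a \<in> L \<Longrightarrow> r * a \<in> ipow S L (k + 1)" by (auto simp: colon_def)
  have "ord_ge C k r" if C: "mc C" for C
  proof (rule ccontr)
    assume "\<not> ord_ge C k r"
    \<comment> \<open>\<open>ord_ge C 0\<close> always holds, so \<open>k\<close> is positive and
      can take the successor form of \<open>not_ord_ge_mult\<close>.\<close>
    then have k: "k \<noteq> 0" "\<not> ord_ge C (Suc (k - 1)) r" by (cases k; simp)+
    obtain i where i: "i \<in> C" using mc_nonempty[OF C] by blast
    obtain e where e: "e \<in> E" "supp e \<inter> C = {i}" using min_cover_private_edge[OF C i] by blast
    have "lk e j = 0" if "j \<in> C - {i}" for j
    proof -
      have "j \<notin> supp e" using e(2) that by blast
      then show ?thesis by (simp add: in_keys_iff)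
    qed
    then have "weight C e = lk e i"
      unfolding weight_def by (subst sum.remove[OF mc_finite[OF C] i]) simp
    then have "weight C e \<le> 1" using sq e(1) by (auto simp: sqfree_def)
    then have "\<not> ord_ge C (Suc 1) (monom e :: 'k mpoly)" by (simp add: ord_ge_def)
    from not_ord_ge_mult[OF k(2) this] have "\<not> ord_ge C (k + 1) (r * monom e)" using k(1) by simp
    moreover have "r * monom e \<in> ipow S L (k + 1)" using r(2) edge_in_L[OF e(1)] by blast
    ultimately show False using C by (simp add: ipow_L)
  qed
  then show "r \<in> ipow S L k" using r(1) by (simp add: ipow_L)
next
  fix k r assume r: "r \<in> ipow S L k"
  have "r * a \<in> ipow S L (k + 1)" if a: "a \<in> L" for a
  proof -
    have "a \<in> ipow S L 1" using a ipow_1[OF ideal_in_L] by simp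
    then show ?thesis using r by (simp add: ipow_L S_mult ord_ge_mult[of _ k _ "Suc 0", simplified])
  qed
  then show "r \<in> colon S (ipow S L (k + 1)) L" using r by (simp add: colon_def ipow_L)
qed

text \<open>An element outside the prime of \<open>C\<close> has order 0 there, so multiplying by it
  cannot raise the order of \<open>r\<close>; conversely 1 serves as denominator.\<close>

lemma symb_pow_L: "symb_pow S L k = ipow S L k"
proof (intro equalityI subsetI)
  fix r assume "r \<in> symb_pow S L k"
  then have r: "r \<in> S" "\<And>C. mc C \<Longrightarrow> \<exists>s\<in>S - var_prime V C. s * r \<in> ipow S L k"
    by (auto simp: symb_pow_def Min_primes_L)
  have "ord_ge C k r" if C: "mc C" for C
  proof (rule ccontr)
    assume n: "\<not> ord_ge C k r"
    then have k: "k \<noteq> 0" "\<not> ord_ge C (Suc (k - 1)) r" by (cases k; simp)+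
    obtain s where s: "s \<in> S" "s \<notin> var_prime V C" "s * r \<in> ipow S L k" using r(2)[OF C] by blast
    have "\<not> ord_ge C (Suc 0) s" using s(1,2) by (simp add: var_prime_def S_def)
    from not_ord_ge_mult[OF this k(2)] have "\<not> ord_ge C k (s * r)" using k(1) by simp
    then show False using s(3) C by (simp add: ipow_L)
  qed
  then show "r \<in> ipow S L k" using r(1) by (simp add: ipow_L)
next
  fix r assume r: "r \<in> ipow S L k"
  have "\<exists>s\<in>S - P. s * r \<in> ipow S L k" if "P \<in> Min_primes S L" for P
  proof
    show "1 * r \<in> ipow S L k" using r by simp
    show "1 \<in> S - P"
      using that one_notin_prime[of V P] by (auto simp: Min_primes_def S_def)
  qed
  then show "r \<in> symb_pow S L k" using r by (simp add: symb_pow_def ipow_L)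
qed

lemma symbolic_strong_persistence_L: "symbolic_strong_persistence S L"
  using strong_persistence_L ipow_1[OF ideal_in_L]
  by (simp add: symbolic_strong_persistence_def strong_persistence_def symb_pow_L)

text \<open>If \<open>r\<close> had exact order \<open>e < k\<close> at some \<open>C\<close>, each
  \<open>a i * r ^ (d - i)\<close> would have order at least \<open>k * i + e * (d - i)\<close>,
  which exceeds \<open>e * d\<close>, while \<open>r ^ d\<close> has order exactly
  \<open>e * d\<close>.\<close>

lemma normal_L: "normal_ideal S L"
  unfolding normal_ideal_def
proof (intro allI impI equalityI subsetI)
  fix k r assume "r \<in> integral_closure S (ipow S L k)"
  then obtain d a where r: "r \<in> S" and d: "d \<ge> 1" and a: "\<And>i. i \<in> {1..d} \<Longrightarrow> a i \<in> ipow S (ipow S L k) i"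
    and eq: "r ^ d + (\<Sum>i=1..d. a i * r ^ (d - i)) = 0"
    unfolding integral_closure_def integral_over_def by blast
  have "ord_ge C k r" if C: "mc C" for C
  proof (rule ccontr)
    assume "\<not> ord_ge C k r"
    then obtain e where e: "e < k" "ord_ge C e r" "\<not> ord_ge C (Suc e) r" using exact_order by blast
    have ord_a: "ord_ge C (k * i) x" if "x \<in> ipow S (ipow S L k) i" for i x
    proof -
      have prods: "set xs \<subseteq> ipow S L k \<Longrightarrow> prod_list xs \<in> S \<and> ord_ge C (k * length xs) (prod_list xs)" for xs
      proof (induction xs)
        case (Cons x xs)
        then show ?case using C by (simp add: ipow_L S_mult ord_ge_mult)
      qed (simp add: S_def)
      have "ipow S (ipow S L k) i \<subseteq> {p \<in> polyring V. ord_ge C (k * i) p}"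
        unfolding ipow_def[of S _ i] unfolding S_def
        by (rule gen_least[OF ideal_in_ord_ge]) (use prods in \<open>auto simp: S_def\<close>)
      then show ?thesis using that by blast
    qed
    have "ord_ge C (Suc (e * d)) (a i * r ^ (d - i))" if i: "i \<in> {1..d}" for i
    proof (rule ord_ge_mono[OF ord_ge_mult[OF ord_a[OF a[OF i]] ord_ge_power[OF e(2)]]])
      have "Suc e * i \<le> k * i" using e(1) by (intro mult_right_mono) auto
      moreover have "e * d = e * i + e * (d - i)" using i by (simp flip: distrib_left)
      ultimately show "Suc (e * d) \<le> k * i + e * (d - i)" using i by simp
    qed
    then have "ord_ge C (Suc (e * d)) (\<Sum>i=1..d. a i * r ^ (d - i))" by (rule ord_ge_sum)
    moreover have "r ^ d = - (\<Sum>i=1..d. a i * r ^ (d - i))" using eq by (simp add: eq_neg_iff_add_eq_0)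
    ultimately have "ord_ge C (Suc (e * d)) (r ^ d)" by (simp add: ord_ge_uminus)
    then show False using not_ord_ge_power[OF e(3)] by blast
  qed
  then show "r \<in> ipow S L k" using r by (simp add: ipow_L)
next
  fix k r assume r: "r \<in> ipow S L k"
  have "ideal_in S (ipow S L k)"
    unfolding S_def L_def ipow_monom_eq[OF EV] by (rule ideal_in_pow)
  then have "ipow S (ipow S L k) 1 = ipow S L k" by (rule ipow_1)
  moreover have "- r \<in> ipow S L k"
  proof -
    have "- r \<in> S" if "r \<in> S" using that by (simp add: S_def polyring_def)
    then show ?thesis using r by (simp add: ipow_L ord_ge_uminus)
  qed
  \<comment> \<open>\<open>r\<close> is a root of the linear equation with constant coefficient
    \<open>- r\<close>.\<close>
  ultimately have "integral_over S (ipow S L k) r"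
    unfolding integral_over_def by (intro exI[of _ 1] conjI exI[of _ "\<lambda>_. - r"]) simp_all
  then show "r \<in> integral_closure S (ipow S L k)" using r by (simp add: integral_closure_def ipow_L)
qed

end

section \<open>From the given ideals to hypergraphs of exponents\<close>

theorem theorem3p8:
  fixes I :: "'k::field mpoly set" and u :: "nat \<Rightarrow> 'k mpoly" and f :: "'k mpoly"
    and n m :: nat
  defines "R \<equiv> polyring {1..n} :: 'k mpoly set"
      and "S \<equiv> polyring {1..n+m} :: 'k mpoly set"
  defines "L \<equiv> gen S (u ` {1..m-1} \<union> {f * (\<Prod>i\<in>{n+1..n+m}. var i)})"
  assumes "m \<ge> 1"
      and "squarefree_monomial_ideal R I"
      and "normally_torsion_free R I"
      and "mingens I = u ` {1..m}" and "inj_on u {1..m}"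
      and "squarefree_monomial f" and "f dvd u m"
      and "\<forall>P\<in>Min_primes S L. f * (\<Prod>i\<in>{n+1..n+m}. var i) \<notin> ipow S P 2"
      and "normally_torsion_free S (gen S (u ` {1..m-1}))"
  shows "normally_torsion_free S L \<and> nearly_normally_torsion_free S L \<and> normal_ideal S L
     \<and> strong_persistence S L \<and> persistence S L \<and> symbolic_strong_persistence S L"
proof -
  let ?V = "{1..n+m}"
  have "\<exists>e. u i = monom e \<and> (\<forall>j. lk e j \<le> 1) \<and> supp e \<subseteq> {1..n}" if i: "i \<in> {1..m}" for i
  proof -
    have ui: "u i \<in> mingens I" using assms(7) i by blast
    then obtain e where e: "u i = monom e" "\<forall>j. lk e j \<le> 1"
      using assms(5) by (auto simp: squarefree_monomial_ideal_def squarefree_monomial_def)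
    have "u i \<in> I" using ui by (auto simp: mingens_def)
    then have "u i \<in> R"
      using assms(5) by (auto simp: squarefree_monomial_ideal_def monomial_ideal_def ideal_in_def)
    then show ?thesis using e by (auto simp: R_def)
  qed
  then obtain e where e: "\<And>i. i \<in> {1..m} \<Longrightarrow> u i = monom (e i) \<and> (\<forall>j. lk (e i) j \<le> 1) \<and> supp (e i) \<subseteq> {1..n}"
    by metis
  obtain a where a: "f = monom a" "\<forall>j. lk a j \<le> 1" using assms(9) by (auto simp: squarefree_monomial_def)
  \<comment> \<open>Divisibility of \<open>u m\<close> by \<open>f\<close> serves to confine
    \<open>f\<close> to the old variables: \<open>q\<close> need not be a monomial a priori, but its
    shifted support is \<open>{e m}\<close>.\<close>
  obtain q where q: "u m = q * monom a" using assms(10) a(1) by (auto simp: dvd_def mult.commute)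
  have em: "u m = monom (e m)" "supp (e m) \<subseteq> {1..n}" using e[of m] assms(4) by auto
  have "{e m} = (\<lambda>t. t + a) ` supp q" using q em(1) supp_mult_monom[of q a] by (metis supp_monom)
  then obtain t where "e m = t + a" by blast
  then have supp_a: "supp a \<subseteq> {1..n}" using em(2) by (simp add: supp_add_expo)
  define h where "h = a + (\<Sum>i\<in>{n+1..n+m}. Poly_Mapping.single i 1)"
  define J where "J = e ` {1..m-1}"
  have h: "monom h = f * (\<Prod>i\<in>{n+1..n+m}. var i)"
    by (simp add: h_def a(1) var_def monom_sum flip: monom_mult)
  have lh: "lk h j = lk a j + (if j \<in> {n+1..n+m} then 1 else 0)" for j
    by (auto simp: h_def lookup_add lookup_sum lookup_single when_def)
  have supp_h: "supp h \<subseteq> ?V"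
  proof
    fix j assume "j \<in> supp h"
    then have "j \<in> supp a \<or> j \<in> {n+1..n+m}" by (auto simp: in_keys_iff lh split: if_splits)
    then show "j \<in> ?V" using supp_a by auto
  qed
  have h1: "\<forall>j. lk h j \<le> 1"
  proof
    fix j show "lk h j \<le> 1"
    \<comment> \<open>\<open>f\<close> uses old variables only, so it shares none with the new ones
      and the product stays square-free.\<close>
    proof (cases "j \<in> supp a")
      case True
      then have "j \<notin> {n+1..n+m}" using supp_a by auto
      then show ?thesis using a(2)[rule_format, of j] by (simp only: lh if_False add_0_right)
    qed (simp add: lh in_keys_iff)
  qed
  have uJ: "u ` {1..m-1} = monom ` J"
    unfolding J_def image_image by (rule image_cong) (use e in auto)
  have JV: "\<forall>x\<in>J. supp x \<subseteq> ?V" and Jsq: "sqfree J" using e by (fastforce simp: J_def sqfree_def)+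
  have L: "L = gen S (monom ` insert h J)"
    unfolding L_def uJ image_insert h by simp
  have mengJ: "mengerian ?V J"
    using normally_torsion_free_imp_mengerian[OF finite_atLeastAtMost JV Jsq assms(12)[unfolded uJ S_def]] .
  \<comment> \<open>Interpreted before the Mengerian property is known, since the description of the
    minimal primes is needed to prove it.\<close>
  interpret edge_ideal ?V "insert h J" S L
    by unfold_locales (use JV Jsq supp_h h1 S_def L in \<open>auto simp: sqfree_def\<close>)
  have "weight C h \<le> 1" if C: "mc C" for C
  proof (rule ccontr)
    assume "\<not> weight C h \<le> 1"
    then have "(monom h :: 'k mpoly) \<in> ipow S (var_prime ?V C) 2"
      using monom_in_ipow2[OF mc_finite[OF C] _ supp_h] C by (simp add: S_def min_cover_def)
    then show False using assms(11) h C by (auto simp: Min_primes_L)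
  qed
  then have "mengerian ?V (insert h J)" by (intro mengerian_insert[OF _ mengJ supp_h h1]) auto
  then interpret mengerian_ideal ?V "insert h J" S L by unfold_locales
  show ?thesis
    using ntf_L nearly_ntf_L normal_L strong_persistence_L persistence_L symbolic_strong_persistence_L
    by blast
qed

end
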